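(* Let $F$ be Thompson's group with generating set $\{x_0,x_1\}$, and let $\mathcal{S}\subset F$ be the family of elements $w_{l,m} = x_0^{m-1} x_1 x_{m+2l+2}\, x_{m+2l+1}^{-1} x_{m+2l-1}^{-1} x_{m+2l-3}^{-1}\cdots x_{m+3}^{-1} x_{m+1}^{-1}\, x_0^{-m}$, where $l,m$ are positive integers. Given any constant $k$, there is $w\in\mathcal{S}$ such that $w$, $wx_0$ and $wx_0^{-1}$ cannot be represented by geodesic paths from the identity in the Cayley graph $\Gamma(F,\{x_0,x_1\})$ which satisfy the $k$-fellow traveller property; that is, there do not exist geodesic paths $\gamma,\gamma_+,\gamma_-$ from the identity to $w$, $wx_0$, $wx_0^{-1}$ respectively such that every two of these paths whose endpoints are at distance one $k$-fellow travel.
   Context: Thompson's group is $F = \langle x_0, x_1 \mid [x_0x_1^{-1},\, x_0^{-1}x_1x_0],\ [x_0x_1^{-1},\, x_0^{-2}x_1x_0^{2}]\rangle$. It also has the infinite presentation $F=\langle x_n,\ n\ge 0 \mid x_i^{-1}x_jx_i = x_{j+1} \text{ if } i<j\rangle$, so that for $n\ge 1$ the element $x_n$ is $x_0^{-(n-1)}x_1x_0^{n-1}$. In $w_{l,m}$ the indices of the inverse generators between $x_{m+2l+2}$ and $x_0^{-m}$ decrease by $2$ from $m+2l+1$ to $m+1$. In the Cayley graph $\Gamma=\Gamma(F,\{x_0,x_1\})$, with vertex set $F$, vertices $v$ and $vg$ are joined by an edge for $g\in\{x_0^{\pm1},x_1^{\pm1}\}$; $d_\Gamma$ is the resulting word metric.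 A path $\gamma$ from the identity to $w$, written as a product $\prod_{i=1}^n g_i$ of elements $g_i \in\{x_0^{\pm1},x_1^{\pm1}\}$, is viewed as an eventually constant map $\mathbb{Z}^+\to F$ by $\gamma(i)=\prod_{j=1}^i g_j$ for $i\le n$ and $\gamma(i)=w$ for $i>n$. It is geodesic if $n$ is the word length of $w$. The synchronous distance between two such paths $\gamma,\eta$ is $D_s(\gamma,\eta)=\max_{i\in\mathbb{Z}^+} d_\Gamma(\gamma(i),\eta(i))$. Two paths $\gamma$ and $\eta$ from the identity to $w$ and $v$, with $d_\Gamma(w,v)=1$, are said to $k$-fellow travel if $D_s(\gamma,\eta)\le k$. A collection of paths satisfies the $k$-fellow traveller property if every pair of its paths ending at vertices at distance one $k$-fellow travel. *)

theory Defs
  imports Complex_Main "HOL-Algebra.Group"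
begin

section \<open>Groups given by generators and relators\<close>

text \<open>A letter \<open>(a, True)\<close> stands for the generator \<open>a\<close> and \<open>(a, False)\<close> for its inverse.\<close>

type_synonym 'a word = "('a \<times> bool) list"

definition word_inv :: "'a word \<Rightarrow> 'a word" where
  "word_inv u = rev (map (\<lambda>(a, b). (a, \<not> b)) u)"

inductive pres_eq :: "'a word set \<Rightarrow> 'a word \<Rightarrow> 'a word \<Rightarrow> bool" for R where
  pres_refl: "pres_eq R u u"
| pres_sym: "pres_eq R u v \<Longrightarrow> pres_eq R v u"
| pres_trans: "pres_eq R u v \<Longrightarrow> pres_eq R v w \<Longrightarrow> pres_eq R u w"
| pres_cong: "pres_eq R u u' \<Longrightarrow> pres_eq R v v' \<Longrightarrow> pres_eq R (u @ v) (u' @ v')"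
| pres_cancel: "pres_eq R [(a, b), (a, \<not> b)] []"
| pres_relator: "r \<in> R \<Longrightarrow> pres_eq R r []"

definition pres_class :: "'a word set \<Rightarrow> 'a word \<Rightarrow> 'a word set" where
  "pres_class R u = {v. pres_eq R u v}"

definition presented_group :: "'a word set \<Rightarrow> 'a word set monoid" where
  "presented_group R =
    \<lparr>carrier = range (pres_class R),
     monoid.mult = (\<lambda>A B. \<Union>u\<in>A. \<Union>v\<in>B. pres_class R (u @ v)),
     one = pres_class R []\<rparr>"

lemma pres_class_eq_iff: "pres_class R u = pres_class R v \<longleftrightarrow> pres_eq R u v"
  unfolding pres_class_def by (auto intro: pres_refl pres_sym pres_trans)

lemma presented_group_mult:
  "pres_class R u \<otimes>\<^bsub>presented_group R\<^esub> pres_class R v = pres_class R (u @ v)"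
proof -
  have eq: "pres_class R (u' @ v') = pres_class R (u @ v)"
    if "u' \<in> pres_class R u" "v' \<in> pres_class R v" for u' v'
    using that unfolding pres_class_eq_iff
    by (auto simp: pres_class_def intro: pres_sym pres_cong)
  have ne: "pres_class R u \<noteq> {}" "pres_class R v \<noteq> {}"
    using pres_refl by (fastforce simp: pres_class_def)+
  have "pres_class R u \<otimes>\<^bsub>presented_group R\<^esub> pres_class R v =
      (\<Union>u'\<in>pres_class R u. \<Union>v'\<in>pres_class R v. pres_class R (u' @ v'))"
    by (simp add: presented_group_def)
  also have "\<dots> = (\<Union>u'\<in>pres_class R u. \<Union>v'\<in>pres_class R v. pres_class R (u @ v))"
    using eq by (intro SUP_cong refl) blast
  also have "\<dots> = pres_class R (u @ v)"
    using ne by (simp add: UN_constant)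
  finally show ?thesis .
qed

lemma presented_group_one: "\<one>\<^bsub>presented_group R\<^esub> = pres_class R []"
  by (simp add: presented_group_def)

lemma presented_group_carrier: "carrier (presented_group R) = range (pres_class R)"
  by (simp add: presented_group_def)

lemma pres_eq_word_inv: "pres_eq R (word_inv u @ u) []"
proof (induction u)
  case Nil
  show ?case by (simp add: word_inv_def pres_refl)
next
  case (Cons x u)
  obtain a b where x: "x = (a, b)" by (cases x)
  have "pres_eq R ([(a, \<not> b), (a, b)] @ u) ([] @ u)"
    using pres_cancel[of R a "\<not> b"] by (intro pres_cong pres_refl) simp
  then have "pres_eq R (word_inv u @ ([(a, \<not> b), (a, b)] @ u)) (word_inv u @ u)"
    by (intro pres_cong pres_refl) simp
  then have "pres_eq R (word_inv u @ ([(a, \<not> b), (a, b)] @ u)) []"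
    using Cons.IH by (rule pres_trans)
  then show ?case by (simp add: x word_inv_def)
qed

lemma group_presented_group: "group (presented_group R)"
proof (rule groupI)
  fix x assume "x \<in> carrier (presented_group R)"
  then obtain u where u: "x = pres_class R u"
    by (auto simp: presented_group_carrier)
  have "pres_class R (word_inv u) \<otimes>\<^bsub>presented_group R\<^esub> x = \<one>\<^bsub>presented_group R\<^esub>"
    by (simp add: u presented_group_mult presented_group_one pres_class_eq_iff pres_eq_word_inv)
  then show "\<exists>y\<in>carrier (presented_group R).
      y \<otimes>\<^bsub>presented_group R\<^esub> x = \<one>\<^bsub>presented_group R\<^esub>"
    by (auto simp: presented_group_carrier)
qed (auto simp: presented_group_carrier presented_group_mult presented_group_one)

section \<open>Cayley graphs, geodesics and fellow travelling\<close>

definition sym_gens :: "('a, 'b) monoid_scheme \<Rightarrow> 'a set \<Rightarrow> 'a set" where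
  "sym_gens G X = X \<union> m_inv G ` X"

definition list_mult :: "('a, 'b) monoid_scheme \<Rightarrow> 'a list \<Rightarrow> 'a" where
  "list_mult G gs = foldr (\<lambda>g h. g \<otimes>\<^bsub>G\<^esub> h) gs \<one>\<^bsub>G\<^esub>"

definition word_length :: "('a, 'b) monoid_scheme \<Rightarrow> 'a set \<Rightarrow> 'a \<Rightarrow> nat" where
  "word_length G X w =
    (LEAST n. \<exists>gs. set gs \<subseteq> sym_gens G X \<and> length gs = n \<and> list_mult G gs = w)"

definition cayley_edges :: "('a, 'b) monoid_scheme \<Rightarrow> 'a set \<Rightarrow> ('a \<times> 'a) set" where
  "cayley_edges G X = {(v, v \<otimes>\<^bsub>G\<^esub> g) |v g. v \<in> carrier G \<and> g \<in> sym_gens G X}"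

definition cayley_dist :: "('a, 'b) monoid_scheme \<Rightarrow> 'a set \<Rightarrow> 'a \<Rightarrow> 'a \<Rightarrow> nat" where
  "cayley_dist G X u v = (LEAST n. (u, v) \<in> cayley_edges G X ^^ n)"

text \<open>A path from the identity is the list of its successive generators. Since \<open>take i gs = gs\<close>
  for \<open>i > length gs\<close>, the map \<open>path_at G gs\<close> is eventually constant.\<close>

definition is_path :: "('a, 'b) monoid_scheme \<Rightarrow> 'a set \<Rightarrow> 'a list \<Rightarrow> bool" where
  "is_path G X gs \<longleftrightarrow> set gs \<subseteq> sym_gens G X"

definition path_at :: "('a, 'b) monoid_scheme \<Rightarrow> 'a list \<Rightarrow> nat \<Rightarrow> 'a" where
  "path_at G gs i = list_mult G (take i gs)"

definition path_end :: "('a, 'b) monoid_scheme \<Rightarrow> 'a list \<Rightarrow> 'a" where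
  "path_end G gs = list_mult G gs"

definition geodesic_to :: "('a, 'b) monoid_scheme \<Rightarrow> 'a set \<Rightarrow> 'a \<Rightarrow> 'a list \<Rightarrow> bool" where
  "geodesic_to G X w gs \<longleftrightarrow>
    is_path G X gs \<and> path_end G gs = w \<and> length gs = word_length G X w"

definition sync_dist :: "('a, 'b) monoid_scheme \<Rightarrow> 'a set \<Rightarrow> 'a list \<Rightarrow> 'a list \<Rightarrow> nat" where
  "sync_dist G X p q = Max ((\<lambda>i. cayley_dist G X (path_at G p i) (path_at G q i)) ` {1..})"

definition fellow_traveller_property ::
    "('a, 'b) monoid_scheme \<Rightarrow> 'a set \<Rightarrow> real \<Rightarrow> 'a list set \<Rightarrow> bool" where
  "fellow_traveller_property G X k P \<longleftrightarrow>
    (\<forall>p\<in>P. \<forall>q\<in>P. cayley_dist G X (path_end G p) (path_end G q) = 1 \<longrightarrow>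
      real (sync_dist G X p q) \<le> k)"

text \<open>The maximum in \<open>sync_dist\<close> ranges over a finite set of values.\<close>

lemma finite_sync_dist_values:
  "finite ((\<lambda>i. cayley_dist G X (path_at G p i) (path_at G q i)) ` {1..})"
proof (rule finite_subset)
  let ?f = "\<lambda>i. cayley_dist G X (path_at G p i) (path_at G q i)"
  let ?N = "max (length p) (length q)"
  have "?f i \<in> ?f ` {..?N}" for i
  proof (cases "i \<le> ?N")
    case False
    then have "?f i = ?f ?N" by (simp add: path_at_def)
    then show ?thesis by blast
  qed auto
  then show "?f ` {1..} \<subseteq> ?f ` {..?N}" by blast
qed simp

text \<open>The graph distance is the word metric.\<close>

lemma cayley_edges_relpow_iff:
  assumes "group G" "X \<subseteq> carrier G" "u \<in> carrier G"
  shows "(u, v) \<in> cayley_edges G X ^^ n \<longleftrightarrow>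
    (\<exists>gs. set gs \<subseteq> sym_gens G X \<and> length gs = n \<and> v = u \<otimes>\<^bsub>G\<^esub> list_mult G gs)"
  using assms(3)
proof (induction n arbitrary: u)
  interpret group G by fact
  case 0
  then show ?case by (auto simp: list_mult_def)
next
  interpret group G by fact
  case (Suc n)
  have S: "sym_gens G X \<subseteq> carrier G" using assms(2) by (auto simp: sym_gens_def)
  have L: "list_mult G gs \<in> carrier G" if "set gs \<subseteq> sym_gens G X" for gs
    using that S by (induction gs) (auto simp: list_mult_def)
  have "(u, v) \<in> cayley_edges G X ^^ Suc n \<longleftrightarrow>
      (\<exists>g\<in>sym_gens G X. (u \<otimes>\<^bsub>G\<^esub> g, v) \<in> cayley_edges G X ^^ n)"
  proof
    assume "(u, v) \<in> cayley_edges G X ^^ Suc n"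
    then obtain y where "(u, y) \<in> cayley_edges G X" "(y, v) \<in> cayley_edges G X ^^ n"
      by (rule relpow_Suc_E2)
    then show "\<exists>g\<in>sym_gens G X. (u \<otimes>\<^bsub>G\<^esub> g, v) \<in> cayley_edges G X ^^ n"
      by (auto simp: cayley_edges_def)
  next
    assume "\<exists>g\<in>sym_gens G X. (u \<otimes>\<^bsub>G\<^esub> g, v) \<in> cayley_edges G X ^^ n"
    then obtain g where "g \<in> sym_gens G X" "(u \<otimes>\<^bsub>G\<^esub> g, v) \<in> cayley_edges G X ^^ n"
      by blast
    moreover from this(1) have "(u, u \<otimes>\<^bsub>G\<^esub> g) \<in> cayley_edges G X"
      using Suc.prems unfolding cayley_edges_def by blast
    ultimately show "(u, v) \<in> cayley_edges G X ^^ Suc n"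
      by (blast intro: relpow_Suc_I2)
  qed
  also have "\<dots> \<longleftrightarrow> (\<exists>g\<in>sym_gens G X. \<exists>gs. set gs \<subseteq> sym_gens G X \<and> length gs = n \<and>
      v = (u \<otimes>\<^bsub>G\<^esub> g) \<otimes>\<^bsub>G\<^esub> list_mult G gs)"
    using Suc S by (intro bex_cong) auto
  also have "\<dots> \<longleftrightarrow> (\<exists>g\<in>sym_gens G X. \<exists>gs. set gs \<subseteq> sym_gens G X \<and> length gs = n \<and>
      v = u \<otimes>\<^bsub>G\<^esub> list_mult G (g # gs))"
  proof -
    have "(u \<otimes>\<^bsub>G\<^esub> g) \<otimes>\<^bsub>G\<^esub> list_mult G gs = u \<otimes>\<^bsub>G\<^esub> list_mult G (g # gs)"
      if "g \<in> sym_gens G X" "set gs \<subseteq> sym_gens G X" for g gs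
      using Suc.prems that S L[OF that(2)] by (simp add: list_mult_def m_assoc subsetD)
    then show ?thesis by (metis (no_types, lifting))
  qed
  also have "\<dots> \<longleftrightarrow> (\<exists>gs. set gs \<subseteq> sym_gens G X \<and> length gs = Suc n \<and>
      v = u \<otimes>\<^bsub>G\<^esub> list_mult G gs)"
    (is "?L \<longleftrightarrow> ?R")
  proof
    assume ?L
    then obtain g gs where "g \<in> sym_gens G X" "set gs \<subseteq> sym_gens G X" "length gs = n"
        "v = u \<otimes>\<^bsub>G\<^esub> list_mult G (g # gs)" by blast
    then show ?R by (intro exI[of _ "g # gs"]) simp
  next
    assume ?R
    then obtain hs where hs: "set hs \<subseteq> sym_gens G X" "length hs = Suc n"
        "v = u \<otimes>\<^bsub>G\<^esub> list_mult G hs" by blast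
    from hs(2) obtain g gs where "hs = g # gs" "length gs = n" by (auto simp: length_Suc_conv)
    with hs show ?L by auto
  qed
  finally show ?case .
qed

lemma cayley_dist_eq_word_length:
  assumes "group G" "X \<subseteq> carrier G" "u \<in> carrier G" "v \<in> carrier G"
  shows "cayley_dist G X u v = word_length G X (inv\<^bsub>G\<^esub> u \<otimes>\<^bsub>G\<^esub> v)"
proof -
  interpret group G by fact
  have S: "sym_gens G X \<subseteq> carrier G" using assms(2) by (auto simp: sym_gens_def)
  have L: "list_mult G gs \<in> carrier G" if "set gs \<subseteq> sym_gens G X" for gs
    using that S by (induction gs) (auto simp: list_mult_def)
  have "v = u \<otimes>\<^bsub>G\<^esub> list_mult G gs \<longleftrightarrow> list_mult G gs = inv\<^bsub>G\<^esub> u \<otimes>\<^bsub>G\<^esub> v"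
    if "set gs \<subseteq> sym_gens G X" for gs
    using L[OF that] assms inv_solve_left by metis
  then have "(\<lambda>n. (u, v) \<in> cayley_edges G X ^^ n) = (\<lambda>n. \<exists>gs. set gs \<subseteq> sym_gens G X \<and>
      length gs = n \<and> list_mult G gs = inv\<^bsub>G\<^esub> u \<otimes>\<^bsub>G\<^esub> v)"
    unfolding cayley_edges_relpow_iff[OF assms(1-3)] by blast
  then show ?thesis by (simp add: cayley_dist_def word_length_def)
qed

section \<open>Thompson's group\<close>

datatype thompson_gen = X0 | X1

definition word_commutator :: "'a word \<Rightarrow> 'a word \<Rightarrow> 'a word" where
  "word_commutator u v = u @ v @ word_inv u @ word_inv v"

definition thompson_relators :: "thompson_gen word set" where
  "thompson_relators =
    {word_commutator [(X0, True), (X1, False)] [(X0, False), (X1, True), (X0, True)],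
     word_commutator [(X0, True), (X1, False)]
       [(X0, False), (X0, False), (X1, True), (X0, True), (X0, True)]}"

definition thompson_F :: "thompson_gen word set monoid" where
  "thompson_F = presented_group thompson_relators"

text \<open>The elements \<open>x\<^sub>n\<close> of the infinite presentation; \<open>x\<^sub>0\<close> and \<open>x\<^sub>1\<close> are the two generators.\<close>

fun thompson_x :: "nat \<Rightarrow> thompson_gen word set" where
  "thompson_x 0 = pres_class thompson_relators [(X0, True)]"
| "thompson_x (Suc n) =
    inv\<^bsub>thompson_F\<^esub> (thompson_x 0 [^]\<^bsub>thompson_F\<^esub> n)
      \<otimes>\<^bsub>thompson_F\<^esub> pres_class thompson_relators [(X1, True)]
      \<otimes>\<^bsub>thompson_F\<^esub> (thompson_x 0 [^]\<^bsub>thompson_F\<^esub> n)"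

definition thompson_gens :: "thompson_gen word set set" where
  "thompson_gens = {thompson_x 0, thompson_x 1}"

lemma group_thompson_F: "group thompson_F"
  by (simp add: thompson_F_def group_presented_group)

lemma thompson_x_1: "thompson_x 1 = pres_class thompson_relators [(X1, True)]"
proof -
  interpret group thompson_F by (rule group_thompson_F)
  have "pres_class thompson_relators [(X1, True)] \<in> carrier thompson_F"
    by (simp add: thompson_F_def presented_group_carrier)
  then show ?thesis by simp
qed

text \<open>The inverse factors have indices \<open>m + 2 * j + 1\<close> for \<open>j = l, l - 1, \<dots>, 0\<close>.\<close>

definition thompson_w :: "nat \<Rightarrow> nat \<Rightarrow> thompson_gen word set" where
  "thompson_w l m =
    (thompson_x 0 [^]\<^bsub>thompson_F\<^esub> (m - 1))
      \<otimes>\<^bsub>thompson_F\<^esub> thompson_x 1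
      \<otimes>\<^bsub>thompson_F\<^esub> thompson_x (m + 2 * l + 2)
      \<otimes>\<^bsub>thompson_F\<^esub> list_mult thompson_F
           (map (\<lambda>j. inv\<^bsub>thompson_F\<^esub> thompson_x (m + 2 * j + 1)) (rev [0..<Suc l]))
      \<otimes>\<^bsub>thompson_F\<^esub> inv\<^bsub>thompson_F\<^esub> (thompson_x 0 [^]\<^bsub>thompson_F\<^esub> m)"

definition thompson_S :: "thompson_gen word set set" where
  "thompson_S = {thompson_w l m |l m. l \<ge> 1 \<and> m \<ge> 1}"

end

theory Submission
  imports Defs
begin

text \<open>
  The group \<open>F\<close> acts on the real line by piecewise linear homeomorphisms, \<open>x\<^sub>0\<close> as the translation
  by 1 and \<open>x\<^sub>1\<close> as the map that is the identity on \<open>t \<le> 0\<close>, doubles \<open>[0,1]\<close> and translates by 1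
  beyond. Letting the letters of a word act one after the other, a path in the Cayley graph becomes
  a motion of the points of the line. Only \<open>x\<^sub>1\<^sup>\<plusminus>\<^sup>1\<close> changes slopes, and only close to the origin, so a
  word has to carry every place that it wants to deform to the origin and back.

  The witness is \<open>w = w\<^bsub>1,m\<^esub>\<close> with \<open>m\<close> large. It is the product of a left part, which doubles
  \<open>[1 - m, 2 - m]\<close>, and a right part, which is supported on \<open>t \<ge> 0\<close> and has a break point at 3. Their
  supports are disjoint, so they commute. The element \<open>w x\<^sub>0\<close> is reached by a word of length
  \<open>2 m + 6\<close> that treats the right part first and comes back from the left one, and \<open>w x\<^sub>0\<^sup>-\<^sup>1\<close> by a word of the same length
  that treats the left part first.

  These orders are forced (\<open>left_after_right\<close>, \<open>left_before_right\<close>). Below 0 a point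
  moves only under \<open>x\<^sub>0\<^sup>\<plusminus>\<^sup>1\<close>, so the path of the left interval counts the letters \<open>x\<^sub>0\<^sup>\<plusminus>\<^sup>1\<close>
  (\<open>shifts_ge_travel\<close>). How far left that interval is while 3 is near the origin depends on the
  gap between the two places, and a gap shrinks only through \<open>x\<^sub>1\<^sup>-\<^sup>1\<close> (\<open>gap_ge\<close>). Each
  \<open>x\<^sub>1\<^sup>-\<^sup>1\<close> has to be compensated by an \<open>x\<^sub>1\<close>, which costs as much as the travel it saves.
  The remaining ingredient is local: the point 3 ends at a half-integer with right slope 1, and to
  achieve this a word must double at that point and use an \<open>x\<^sub>1\<^sup>-\<^sup>1\<close> afterwards
  (\<open>stretch_then_shrink\<close>).

  Finally, suppose that both geodesics stay within distance \<open>K\<close> of each other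
  (\<open>short_words_diverge\<close>). At some time the second path has moved the right end of the left interval
  past the origin without having doubled at 3 before. The first path is then \<open>K\<close>-close, so it
  has moved this interval almost as far. As 3 is far away on the right, the two paths have at that
  time the same germ at 3, up to an integer translation. Hence the first path still has to bring 3 to
  the origin, and afterwards, by the forced order, once more the left interval. This takes about
  \<open>4 m\<close> letters, too many for large \<open>m\<close>.

  The lower bounds on lengths come from the action and from the exponent sum of \<open>x\<^sub>1\<close>, which depend
  only on the element that a word represents. The upper bound \<open>2 m + 6\<close> comes from relations in \<open>F\<close>.
\<close>

section \<open>The action on right germs of the line\<close>

type_synonym letter = "thompson_gen \<times> bool"

text \<open>The pair \<open>(t, h)\<close> is the germ at the right of \<open>t\<close> of a map with slope \<open>2\<^sup>h\<close> there. The letter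
  \<open>x\<^sub>1\<close> doubles the right germ at 0 but not the one at 1, hence the half-open interval \<open>[0,1)\<close>.\<close>

fun move :: "letter \<Rightarrow> real \<times> int \<Rightarrow> real \<times> int" where
  "move (X0, True) (t, h) = (t + 1, h)"
| "move (X0, False) (t, h) = (t - 1, h)"
| "move (X1, True) (t, h) =
    (if t < 0 then (t, h) else if t < 1 then (2 * t, h + 1) else (t + 1, h))"
| "move (X1, False) (t, h) =
    (if t < 0 then (t, h) else if t < 2 then (t / 2, h - 1) else (t - 1, h))"

definition run :: "letter list \<Rightarrow> real \<times> int \<Rightarrow> real \<times> int" where
  "run W = fold move W"

lemma run_simps [simp]:
  "run [] s = s" "run (c # W) s = run W (move c s)" "run (U @ V) s = run V (run U s)"
  by (simp_all add: run_def)

lemma letter_cases [case_names forward backward stretch shrink]: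
  assumes "c = (X0, True) \<Longrightarrow> P" "c = (X0, False) \<Longrightarrow> P"
    "c = (X1, True) \<Longrightarrow> P" "c = (X1, False) \<Longrightarrow> P"
  shows P
  using assms by (metis (full_types) prod.exhaust thompson_gen.exhaust)

lemma run_inverse_letter: "run [(a, b), (a, \<not> b)] s = s"
  by (cases a; cases b; cases s) auto

lemma run_relator: "r \<in> thompson_relators \<Longrightarrow> run r s = s"
  by (cases s) (auto simp: thompson_relators_def word_commutator_def word_inv_def field_simps)

text \<open>Equal elements of \<open>F\<close> act equally on germs, so every statement about the action of words is one
  about \<open>F\<close>.\<close>

lemma run_pres_eq: "pres_eq thompson_relators u v \<Longrightarrow> run u s = run v s"
proof (induction arbitrary: s rule: pres_eq.induct)
  case (pres_cancel a b)
  show ?case using run_inverse_letter by simp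
qed (simp_all add: run_relator)

definition pos :: "letter list \<Rightarrow> real \<Rightarrow> real" where
  "pos W t = fst (run W (t, 0))"

lemma fst_move: "fst (move c (t, h)) = fst (move c (t, 0))"
  by (cases c rule: letter_cases) auto

lemma fst_run: "fst (run W (t, h)) = pos W t"
proof (induction W arbitrary: t h)
  case (Cons c W)
  have "fst (run W (move c (t, h))) = pos W (fst (move c (t, h)))" for h
    using Cons.IH[of "fst (move c (t, h))" "snd (move c (t, h))"] by simp
  then show ?case using fst_move[of c t h] by (simp add: pos_def)
qed (simp add: pos_def)

lemma pos_Nil [simp]: "pos [] t = t"
  by (simp add: pos_def)

lemma pos_append: "pos (U @ V) t = pos V (pos U t)"
  using fst_run[of V "fst (run U (t, 0))" "snd (run U (t, 0))"] by (simp add: pos_def)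

lemma pos_Cons: "pos (c # V) t = pos V (pos [c] t)"
  using pos_append[of "[c]" V] by simp

lemma pos_letter:
  "pos [(X0, True)] t = t + 1" "pos [(X0, False)] t = t - 1"
  "pos [(X1, True)] t = (if t < 0 then t else if t < 1 then 2 * t else t + 1)"
  "pos [(X1, False)] t = (if t < 0 then t else if t < 2 then t / 2 else t - 1)"
  by (simp_all add: pos_def)

definition shifts :: "letter list \<Rightarrow> nat" where
  "shifts W = length (filter (\<lambda>c. fst c = X0) W)"

abbreviation stretches :: "letter list \<Rightarrow> nat" where
  "stretches W \<equiv> count_list W (X1, True)"

abbreviation shrinks :: "letter list \<Rightarrow> nat" where
  "shrinks W \<equiv> count_list W (X1, False)"

lemma shifts_simps [simp]:
  "shifts [] = 0" "shifts (U @ V) = shifts U + shifts V"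
  "shifts (c # W) = (if fst c = X0 then 1 else 0) + shifts W"
  by (simp_all add: shifts_def)

lemma length_eq_shifts: "length W = shifts W + stretches W + shrinks W"
proof (induction W)
  case (Cons c W)
  then show ?case by (cases c rule: letter_cases) auto
qed simp

text \<open>The exponent sum of \<open>x\<^sub>1\<close> is well defined on \<open>F\<close> since both relators are commutators.\<close>

lemma balance_pres_eq:
  "pres_eq thompson_relators u v \<Longrightarrow>
    int (stretches u) - int (shrinks u) = int (stretches v) - int (shrinks v)"
proof (induction rule: pres_eq.induct)
  case (pres_cancel a b)
  show ?case by (cases a; cases b) auto
next
  case (pres_relator r)
  then show ?case
    by (auto simp: thompson_relators_def word_commutator_def word_inv_def)
qed auto

section \<open>How letters move points\<close>

text \<open>A bound on positions at equal times that the word metric imposes on two nearby paths.\<close>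

lemma pos_displacement: "\<bar>pos W t - t\<bar> \<le> length W"
proof (induction W arbitrary: t)
  case (Cons c W)
  have "\<bar>pos [c] t - t\<bar> \<le> 1"
    by (cases c rule: letter_cases) (auto simp: pos_letter)
  with Cons.IH[of "pos [c] t"] show ?case by (subst pos_Cons) auto
qed simp

lemma pos_mono: "s \<le> t \<Longrightarrow> pos W s \<le> pos W t"
proof (induction W arbitrary: s t)
  case (Cons c W)
  have "pos [c] s \<le> pos [c] t"
    using Cons.prems by (cases c rule: letter_cases) (auto simp: pos_letter)
  from Cons.IH[OF this] show ?case by (simp add: pos_Cons[of c W])
qed simp

text \<open>The letters \<open>x\<^sub>1\<^sup>\<plusminus>\<^sup>1\<close> preserve both half-lines and fix the negative one, hence
  they do not change \<open>min t 0\<close>.\<close>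

lemma shifts_ge_travel: "\<bar>min (pos W t) 0 - min t 0\<bar> \<le> shifts W"
proof (induction W arbitrary: t)
  case (Cons c W)
  have "\<bar>min (pos [c] t) 0 - min t 0\<bar> \<le> shifts [c]"
    by (cases c rule: letter_cases) (auto simp: pos_letter)
  moreover have "shifts (c # W) = shifts [c] + shifts W" by simp
  ultimately show ?case
    using Cons.IH[of "pos [c] t"] pos_Cons[of c W]
      abs_triangle_ineq[of "min (pos W (pos [c] t)) 0 - min (pos [c] t) 0" "min (pos [c] t) 0 - min t 0"]
    by simp
qed simp

text \<open>The distance by which \<open>x\<^sub>1\<^sup>-\<^sup>1\<close> moves \<open>t\<close> to the left increases with \<open>t\<close> from 0 to 1, so it
  takes at most 1 from a gap. The letter \<open>x\<^sub>1\<close> widens gaps.\<close>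

lemma gap_ge: "s \<le> t \<Longrightarrow> pos W t - pos W s \<ge> t - s - shrinks W"
proof (induction W arbitrary: s t)
  case (Cons c W)
  have "pos [c] s \<le> pos [c] t" using Cons.prems by (rule pos_mono)
  moreover have "pos [c] t - pos [c] s \<ge> t - s - shrinks [c]"
    using Cons.prems by (cases c rule: letter_cases) (auto simp: pos_letter)
  ultimately show ?case using Cons.IH[of "pos [c] s" "pos [c] t"]
    by (subst (1 2) pos_Cons) (auto split: if_splits)
qed simp

text \<open>As long as \<open>q\<close> is not positive, everything up to \<open>q\<close> is moved by \<open>x\<^sub>0\<^sup>\<plusminus>\<^sup>1\<close> alone, hence by one
  common integer translation. The word \<open>V1\<close> stops as soon as \<open>q\<close> is positive, and it is all of
  \<open>V\<close> if that never happens.\<close>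

lemma rigid_or_cross:
  "\<exists>V1 V2 (d::int). V = V1 @ V2 \<and> \<bar>d\<bar> \<le> shifts V1 \<and> (\<forall>s\<le>q. pos V1 s = s + real_of_int d) \<and>
    (V2 = [] \<or> pos V1 q > 0)"
proof (induction V arbitrary: q)
  case Nil
  show ?case by (intro exI[of _ "[]"] exI[of _ 0]) simp
next
  case (Cons c V)
  show ?case
  proof (cases "q > 0")
    case True
    then show ?thesis by (intro exI[of _ "[]"] exI[of _ "c # V"] exI[of _ 0]) simp
  next
    case False
    have "\<exists>k::int. \<bar>k\<bar> \<le> shifts [c] \<and> (\<forall>s\<le>q. pos [c] s = s + real_of_int k)"
    proof (cases c rule: letter_cases)
      case forward
      then show ?thesis by (intro exI[of _ 1]) (simp add: pos_letter)
    next
      case backward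
      then show ?thesis by (intro exI[of _ "-1"]) (simp add: pos_letter)
    qed (use False in \<open>auto intro!: exI[of _ 0] simp: pos_letter\<close>)
    then obtain k :: int where k: "\<bar>k\<bar> \<le> shifts [c]" "\<forall>s\<le>q. pos [c] s = s + real_of_int k"
      by blast
    obtain V1 V2 d where V: "V = V1 @ V2" "\<bar>d\<bar> \<le> shifts V1"
        "\<forall>s\<le>q + k. pos V1 s = s + real_of_int d" "V2 = [] \<or> pos V1 (q + k) > 0"
      using Cons.IH[of "q + k"] by (elim exE conjE) (rule that)
    have "\<forall>s\<le>q. pos (c # V1) s = s + real_of_int (k + d)"
      using k(2) V(3) by (simp add: pos_Cons[of c V1])
    moreover have "\<bar>k + d\<bar> \<le> shifts (c # V1)" using k(1) V(2) by auto
    moreover have "V2 = [] \<or> pos (c # V1) q > 0"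
      using V(4) k(2) by (simp add: pos_Cons[of c V1])
    ultimately show ?thesis using V(1)
      by (intro exI[of _ "c # V1"] exI[of _ V2] exI[of _ "k + d"]) simp
  qed
qed

text \<open>A point that stays above 2 meets \<open>x\<^sub>1\<^sup>\<plusminus>\<^sup>1\<close> only where these are translations by \<open>\<plusminus>1\<close>.
  As one letter moves a point by at most 1, the final position shows that it stays there.\<close>

lemma run_far_right:
  assumes "fst (run U (t, h)) > length U + 2"
  shows "\<exists>d::int. run U (t, h) = (t + d, h)"
  using assms
proof (induction U arbitrary: t h)
  case Nil
  show ?case by (intro exI[of _ 0]) simp
next
  case (Cons c U)
  obtain t1 h1 where m: "move c (t, h) = (t1, h1)" by (cases "move c (t, h)")
  from Cons.prems m have far: "fst (run U (t1, h1)) > length U + 3" by simp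
  then obtain d :: int where d: "run U (t1, h1) = (t1 + d, h1)"
    using Cons.IH[of t1 h1] by auto
  have "t1 > 3" using far pos_displacement[of U t1] fst_run[of U t1 h1] by linarith
  with m have "\<exists>d::int. (t1, h1) = (t + d, h)"
    by (cases c rule: letter_cases)
      (auto split: if_splits intro: exI[of _ "1::int"] exI[of _ "-1::int"])
  then show ?case using m d by (metis Pair_inject add.assoc of_int_add run_simps(2))
qed

section \<open>Moving a break point to a half-integer\<close>

text \<open>Tame germs are those to which the germ of the identity at an integer can be brought without
  doubling: \<open>n\<close> halvings give slope \<open>2\<^sup>-\<^sup>n\<close>, and at most \<open>n\<close> binary digits after the point.\<close>

definition tame :: "real \<times> int \<Rightarrow> bool" where
  "tame g \<longleftrightarrow> snd g \<le> 0 \<and> fst g * 2 ^ nat (- snd g) \<in> \<int>"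

lemma tame_shift: "tame (t + of_int d, h) \<longleftrightarrow> tame (t, h)"
  by (simp add: tame_def distrib_right)

lemma tame_move:
  assumes "tame (t, h)" "\<not> (c = (X1, True) \<and> 0 \<le> t \<and> t < 1)"
  shows "tame (move c (t, h))"
proof (cases c rule: letter_cases)
  case shrink
  have "nat (1 - h) = Suc (nat (- h))" if "h \<le> 0" using that by simp
  then show ?thesis
    using assms(1) tame_shift[of t "-1" h] shrink by (auto simp: tame_def)
qed (use assms tame_shift[of t 1 h] tame_shift[of t "-1" h] in \<open>auto split: if_splits\<close>)

text \<open>Without \<open>x\<^sub>1\<^sup>-\<^sup>1\<close> an integer point stays integral. At a tame point that is not an
  integer the slope is less than 1, so that doubling leaves an exponent \<open>h \<le> 0\<close>, and it removes
  one binary digit.\<close>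

lemma tame_or_integer_run:
  assumes "t \<in> \<int> \<or> tame (t, h)" "(X1, False) \<notin> set V"
  shows "fst (run V (t, h)) \<in> \<int> \<or> tame (run V (t, h))"
  using assms
proof (induction V arbitrary: t h)
  case (Cons c V)
  obtain t1 h1 where m: "move c (t, h) = (t1, h1)" by (cases "move c (t, h)")
  have "t1 \<in> \<int> \<or> tame (t1, h1)"
  proof (cases "t \<in> \<int>")
    case True
    have "c \<noteq> (X1, False)" using Cons.prems(2) by auto
    then show ?thesis using m True by (cases c rule: letter_cases) (auto split: if_splits)
  next
    case False
    with Cons.prems have tm: "tame (t, h)" by simp
    show ?thesis
    proof (cases "c = (X1, True) \<and> 0 \<le> t \<and> t < 1")
      case True
      have "h \<noteq> 0" using tm False by (auto simp: tame_def)
      then have "nat (- h) = Suc (nat (- h - 1))" "h < 0" using tm by (auto simp: tame_def)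
      then show ?thesis using tm True m by (auto simp: tame_def mult_ac)
    next
      case no: False
      show ?thesis using tame_move[OF tm no] m by simp
    qed
  qed
  with Cons m show ?case by simp
qed simp

text \<open>The split is at the first doubling of the germ, which exists because otherwise the germ would
  remain tame. If no \<open>x\<^sub>1\<^sup>-\<^sup>1\<close> came later, the final germ would be integral or tame by the
  preceding lemma.\<close>

lemma stretch_then_shrink:
  assumes "tame (t, h)" "\<not> tame (run V (t, h))" "fst (run V (t, h)) \<notin> \<int>"
  shows "\<exists>V1 V2. V = V1 @ V2 \<and> pos V1 t < 1 \<and> (X1, False) \<in> set V2 \<and>
    (\<forall>U U'. V1 = U @ U' \<longrightarrow> tame (run U (t, h)))"
  using assms
proof (induction V arbitrary: t h)
  case (Cons c V)
  obtain t1 h1 where m: "move c (t, h) = (t1, h1)" by (cases "move c (t, h)")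
  have p1: "pos [c] t = t1" using m fst_move[of c t h] by (simp add: pos_def)
  show ?case
  proof (cases "c = (X1, True) \<and> 0 \<le> t \<and> t < 1")
    case True
    have "(X1, False) \<in> set (c # V)"
      using tame_or_integer_run[of t h "c # V"] Cons.prems by blast
    then show ?thesis using True Cons.prems(1)
      by (intro exI[of _ "[]"] exI[of _ "c # V"]) auto
  next
    case False
    have "tame (t1, h1)" using tame_move[OF Cons.prems(1) False] m by simp
    moreover from Cons.prems(2,3) m have "\<not> tame (run V (t1, h1))"
      "fst (run V (t1, h1)) \<notin> \<int>" by auto
    ultimately obtain V1 V2 where V: "V = V1 @ V2" "pos V1 t1 < 1" "(X1, False) \<in> set V2"
        "\<And>U U'. V1 = U @ U' \<Longrightarrow> tame (run U (t1, h1))"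
      using Cons.IH by blast
    have "tame (run U (t, h))" if "c # V1 = U @ U'" for U U'
      using that V(4) m Cons.prems(1) by (cases U) auto
    moreover have "pos (c # V1) t < 1" using V(2) p1 by (simp add: pos_Cons[of c V1])
    ultimately show ?thesis using V(1,3)
      by (intro exI[of _ "c # V1"] exI[of _ V2]) auto
  qed
qed simp

section \<open>Short words\<close>

text \<open>A word for \<open>w x\<^sub>0\<close>, given by its effect on the ends of the interval \<open>[1 - m, 2 - m]\<close>.
  The interval has to be doubled, for which its right end must become positive. If this happened
  only before the time after \<open>V1\<close>, when 3 is to the left of 1, then at that time the interval would
  already have its final length 2, its left end would be at \<open>a < shrinks V1 - m - 2\<close>, and
  the way from \<open>1 - m\<close> up to 0, down to \<open>a\<close> and back to \<open>1 - m\<close> would have length at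
  least \<open>- 2 a\<close>.
  At least \<open>shrinks V1 + 1\<close> letters \<open>x\<^sub>1\<^sup>-\<^sup>1\<close>, and as many \<open>x\<^sub>1\<close>, would bring the total above
  \<open>2 m + 6\<close>.\<close>

lemma left_after_right:
  fixes m :: nat
  assumes W: "W = V1 @ V2" and e: "pos V1 3 < 1" and sh: "(X1, False) \<in> set V2"
    and A: "pos W (1 - real m) = 1 - real m" and Q: "pos W (2 - real m) = 3 - real m"
    and bal: "stretches W = shrinks W" and len: "length W \<le> 2 * m + 6"
  shows "\<exists>U U'. V2 = U @ U' \<and> pos (V1 @ U) (2 - real m) > 0"
proof (rule ccontr)
  assume no: "\<not> ?thesis"
  define a q where "a = pos V1 (1 - real m)" and "q = pos V1 (2 - real m)"
  have aq: "a \<le> q" unfolding a_def q_def by (rule pos_mono) simp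
  obtain U U' d where U: "V2 = U @ U'" "\<bar>d\<bar> \<le> shifts U"
      "\<forall>s\<le>q. pos U s = s + real_of_int d" "U' = [] \<or> pos U q > 0"
    using rigid_or_cross[of V2 q] by (elim exE conjE) (rule that)
  with no have U': "U' = []" by (force simp: pos_append q_def)
  have ends: "a + d = 1 - real m" "q + d = 3 - real m"
    using A Q U U' aq by (simp_all add: W pos_append a_def q_def)
  obtain P P' k where P: "V1 = P @ P'" "\<bar>k\<bar> \<le> shifts P"
      "\<forall>s\<le>2 - real m. pos P s = s + real_of_int k" "P' = [] \<or> pos P (2 - real m) > 0"
    using rigid_or_cross[of V1 "2 - real m"] by (elim exE conjE) (rule that)
  \<comment> \<open>The length 2 reached by the time after \<open>V1\<close> shows that the interval was not rigid before.\<close>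
  have "P' \<noteq> []"
  proof
    assume "P' = []"
    then have "q - a = 1" using P by (simp add: a_def q_def)
    then show False using ends by simp
  qed
  then have "2 - real m + k > 0" using P by auto
  then have k: "k \<ge> int m - 1" by linarith
  have "pos P (1 - real m) \<ge> 0" using P(3) k by simp
  moreover have "a = pos P' (pos P (1 - real m))" by (simp add: a_def P(1) pos_append)
  ultimately have "shifts P' \<ge> - a" using shifts_ge_travel[of P' "pos P (1 - real m)"] by auto
  moreover have "shifts P \<ge> real m - 1" using k P(2) by linarith
  moreover have "shifts V2 \<ge> 1 - real m - a" using U(1,2) U' ends by simp
  ultimately have "shifts W \<ge> - 2 * a" using W P(1) by simp
  moreover have "pos V1 3 - q \<ge> 3 - (2 - real m) - shrinks V1"
    unfolding q_def by (rule gap_ge) simp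
  ultimately have "shifts W > 2 * real m + 4 - 2 * shrinks V1" using e ends by simp
  moreover have "shrinks W \<ge> shrinks V1 + 1"
    using sh count_list_0_iff[of V2 "(X1, False)"] by (simp add: W)
  ultimately show False using len length_eq_shifts[of W] bal by simp
qed

text \<open>The same count for \<open>w x\<^sub>0\<^sup>-\<^sup>1\<close>. If the interval were doubled only after the time when
  3 is to the left of 1, it would have length 1 at that time, and its left end would travel from
  \<open>1 - m\<close> down to \<open>a = 1 - m + d\<close>, up to 0 and down to \<open>- 1 - m\<close>, a way of length at least
  \<open>2 m - 2 d\<close>.\<close>

lemma left_before_right:
  fixes m :: nat
  assumes W: "W = V1 @ V2" and e: "pos V1 3 < 1" and sh: "(X1, False) \<in> set V2"
    and A: "pos W (1 - real m) = - 1 - real m" and Q: "pos W (2 - real m) = 1 - real m"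
    and bal: "stretches W = shrinks W" and len: "length W \<le> 2 * m + 6"
  shows "\<exists>U U'. V1 = U @ U' \<and> pos U (2 - real m) > 0"
proof (rule ccontr)
  assume no: "\<not> ?thesis"
  define a q where "a = pos V1 (1 - real m)" and "q = pos V1 (2 - real m)"
  have aq: "a \<le> q" unfolding a_def q_def by (rule pos_mono) simp
  obtain U U' d where U: "V1 = U @ U'" "\<bar>d\<bar> \<le> shifts U"
      "\<forall>s\<le>2 - real m. pos U s = s + real_of_int d" "U' = [] \<or> pos U (2 - real m) > 0"
    using rigid_or_cross[of V1 "2 - real m"] by (elim exE conjE) (rule that)
  with no have U': "U' = []" by blast
  have start: "a = 1 - real m + d" "q = 2 - real m + d"
    using U U' by (simp_all add: a_def q_def)
  obtain P P' k where P: "V2 = P @ P'" "\<bar>k\<bar> \<le> shifts P"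
      "\<forall>s\<le>q. pos P s = s + real_of_int k" "P' = [] \<or> pos P q > 0"
    using rigid_or_cross[of V2 q] by (elim exE conjE) (rule that)
  have "P' \<noteq> []"
  proof
    assume "P' = []"
    then have "pos W (2 - real m) - pos W (1 - real m) = 1"
      using P aq start by (simp add: W pos_append a_def[symmetric] q_def[symmetric])
    then show False using A Q by simp
  qed
  then have "2 - real m + d + k > 0" using P start by auto
  then have k: "d + k \<ge> int m - 1" by linarith
  have "pos P a \<ge> 0" using P(3) aq k start by simp
  moreover have "pos P' (pos P a) = - 1 - real m"
    using A by (simp add: W P(1) pos_append a_def)
  ultimately have "shifts P' \<ge> real m + 1" using shifts_ge_travel[of P' "pos P a"] by auto
  moreover have "shifts P \<ge> k" "shifts V1 \<ge> - d" using P(2) U(1,2) U' by auto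
  ultimately have "shifts W \<ge> 2 * int m - 2 * d" using W P(1) k by simp
  moreover have "pos V1 3 - q \<ge> 3 - (2 - real m) - shrinks V1"
    unfolding q_def by (rule gap_ge) simp
  ultimately have "shifts W > 2 * int m + 4 - 2 * int (shrinks V1)"
    using e start by linarith
  moreover have "shrinks W \<ge> shrinks V1 + 1"
    using sh count_list_0_iff[of V2 "(X1, False)"] by (simp add: W)
  ultimately show False using len length_eq_shifts[of W] bal by simp
qed

text \<open>The words \<open>W\<close> for \<open>w x\<^sub>0\<close> and \<open>W'\<close> for \<open>w x\<^sub>0\<^sup>-\<^sup>1\<close> differ at equal times by words \<open>U\<close> of length
  at most \<open>K\<close>. In the proof \<open>P\<close> is an initial part of \<open>W'\<close> that moves \<open>2 - m\<close> past the origin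
  while the germ at 3 is still tame, and \<open>Q\<close> is the part of \<open>W\<close> up to the same time.\<close>

lemma short_words_diverge:
  fixes m K :: nat
  assumes K: "m \<ge> K + 6" and W: "pos W (1 - real m) = 1 - real m" "pos W (2 - real m) = 3 - real m"
      "run W (3, 0) = (5 / 2, 0)" "stretches W = shrinks W" "length W \<le> 2 * m + 6"
    and W': "pos W' (1 - real m) = - 1 - real m" "pos W' (2 - real m) = 1 - real m"
      "run W' (3, 0) = (1 / 2, 0)" "stretches W' = shrinks W'" "length W' \<le> 2 * m + 6"
    and close: "\<And>i. i \<ge> 1 \<Longrightarrow> \<exists>U. length U \<le> K \<and>
      (\<forall>s. run (take i W @ U) s = run (take i W') s)"
  shows False
proof -
  have half: "x \<notin> \<int>" if "2 * x = of_int n" "odd n" for x :: real and n :: int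
  proof
    assume "x \<in> \<int>"
    then obtain z where "x = of_int z" by (rule Ints_cases)
    with that(1) have "of_int n = (of_int (2 * z) :: real)" by simp
    then have "n = 2 * z" by (simp only: of_int_eq_iff)
    with that(2) show False by simp
  qed
  have wild: "(1 / 2 :: real) \<notin> \<int>" "(5 / 2 :: real) \<notin> \<int>"
    using half[of "1 / 2" 1] half[of "5 / 2" 5] by simp_all
  then have wild': "\<not> tame (1 / 2, 0)" "\<not> tame (5 / 2, 0)" by (simp_all add: tame_def)
  have tame0: "tame (3, 0)" by (simp add: tame_def)
  obtain V V' where V: "W' = V @ V'" "pos V 3 < 1" "(X1, False) \<in> set V'"
      "\<And>P P'. V = P @ P' \<Longrightarrow> tame (run P (3, 0))"
    using stretch_then_shrink[OF tame0, of W'] W'(3) wild wild' by auto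
  obtain P P' where P: "V = P @ P'" "pos P (2 - real m) > 0"
    using left_before_right[OF V(1-3) W'(1,2,4,5)] by blast
  define R where "R = P' @ V'"
  have W'_split: "W' = P @ R" using V(1) P(1) by (simp add: R_def)
  obtain t h where th: "run P (3, 0) = (t, h)" by (cases "run P (3, 0)")
  with V(4) P(1) have th_tame: "tame (t, h)" by force
  have t: "pos P 3 = t" using th by (simp add: pos_def)
  \<comment> \<open>Travelling to the origin and back leaves few letters for shrinking, so 3 is far right after \<open>P\<close>.\<close>
  have "shifts P \<ge> real m - 2"
    using shifts_ge_travel[of P "2 - real m"] P(2) K by auto
  moreover have "shifts R \<ge> real m - 1"
    using shifts_ge_travel[of R "pos P (2 - real m)"] P(2) K W'(2)
    by (auto simp: W'_split pos_append)
  ultimately have "shrinks W' \<le> 4"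
    using W'(4,5) length_eq_shifts[of W'] by (simp add: W'_split)
  then have "shrinks P \<le> 4" by (simp add: W'_split)
  moreover have "t - pos P (2 - real m) \<ge> 3 - (2 - real m) - shrinks P"
    unfolding t[symmetric] by (rule gap_ge) simp
  ultimately have far: "t > real K + 3" using P(2) K by simp
  define Q where "Q = take (length P) W"
  define Y where "Y = drop (length P) W"
  have W_split: "W = Q @ Y" by (simp add: Q_def Y_def)
  have "P \<noteq> []" using P(2) K by auto
  then have "length P \<ge> 1" by (cases P) auto
  from close[OF this] obtain U where U: "length U \<le> K" "\<And>s. run U (run Q s) = run P s"
    by (auto simp: Q_def W'_split)
  obtain t1 h1 where q1: "run Q (3, 0) = (t1, h1)" by (cases "run Q (3, 0)")
  have "run U (t1, h1) = (t, h)" using U(2)[of "(3, 0)"] q1 th by simp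
  then obtain d :: int where "(t, h) = (t1 + d, h1)"
    using run_far_right[of U t1 h1] far U(1) by auto
  \<comment> \<open>The germ at 3 is tame in \<open>W\<close> as well, hence the right part is still to be done.\<close>
  then have "tame (t1, h1)" using th_tame tame_shift[of t1 d h1] by simp
  then obtain V1 V2 where Y: "Y = V1 @ V2" "pos V1 t1 < 1" "(X1, False) \<in> set V2"
    using stretch_then_shrink[of t1 h1 Y] W(3) wild wild' q1 by (auto simp: W_split)
  have "pos Q 3 = t1" using q1 by (simp add: pos_def)
  with Y(2) have e: "pos (Q @ V1) 3 < 1" by (simp add: pos_append)
  have W_split': "W = (Q @ V1) @ V2" by (simp add: W_split Y(1))
  obtain Z Z' where Z: "V2 = Z @ Z'" "pos ((Q @ V1) @ Z) (2 - real m) > 0"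
    using left_after_right[OF W_split' e Y(3) W(1,2,4,5)] by blast
  \<comment> \<open>The point \<open>2 - m\<close> visits, in this order: \<open>q > - K\<close>, far left at \<open>r\<close>, a positive
    position, and the final position \<open>3 - m\<close>.\<close>
  define q where "q = pos Q (2 - real m)"
  define r where "r = pos V1 q"
  have "pos U q = pos P (2 - real m)"
    using U(2)[of "(2 - real m, 0)"] by (metis fst_run pos_append q_def run_simps(3))
  then have "q > - real K" using pos_displacement[of U q] P(2) U(1) by linarith
  moreover have "\<bar>min q 0 - min (2 - real m) 0\<bar> \<le> shifts Q"
    unfolding q_def by (rule shifts_ge_travel)
  moreover have "\<bar>min r 0 - min q 0\<bar> \<le> shifts V1"
    unfolding r_def by (rule shifts_ge_travel)
  moreover have "pos Z r > 0" using Z(2) by (simp add: r_def q_def pos_append)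
  moreover have "\<bar>min (pos Z r) 0 - min r 0\<bar> \<le> shifts Z" by (rule shifts_ge_travel)
  moreover have "pos Z' (pos Z r) = 3 - real m"
    using W(2) by (simp add: W_split' Z(1) r_def q_def pos_append)
  then have "\<bar>min (3 - real m) 0 - min (pos Z r) 0\<bar> \<le> shifts Z'"
    using shifts_ge_travel[of Z' "pos Z r"] by simp
  moreover have "pos (Q @ V1) 3 - r \<ge> 3 - (2 - real m) - shrinks (Q @ V1)"
    unfolding r_def q_def pos_append[symmetric] by (rule gap_ge) simp
  ultimately have "shifts W + 2 * real (shrinks W) > 4 * real m - 5 - 2 * real K"
    using e K by (simp add: W_split' Z(1))
  then show False using W(4,5) K length_eq_shifts[of W] by simp
qed

section \<open>Factorisation into commuting parts\<close>

context group
begin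

definition conj_by :: "'a \<Rightarrow> 'a \<Rightarrow> 'a" where
  "conj_by g h = inv g \<otimes> h \<otimes> g"

lemma conj_by_closed [simp]:
  "g \<in> carrier G \<Longrightarrow> h \<in> carrier G \<Longrightarrow> conj_by g h \<in> carrier G"
  by (simp add: conj_by_def)

lemma cancel_left:
  assumes "g \<in> carrier G" "h \<in> carrier G"
  shows "g \<otimes> (inv g \<otimes> h) = h" "inv g \<otimes> (g \<otimes> h) = h"
  using assms by (simp_all flip: m_assoc)

lemma conj_by_mult:
  assumes "g \<in> carrier G" "h \<in> carrier G" "k \<in> carrier G"
  shows "conj_by g (h \<otimes> k) = conj_by g h \<otimes> conj_by g k"
  using assms by (simp add: conj_by_def m_assoc cancel_left)

lemma conj_by_inv:
  assumes "g \<in> carrier G" "h \<in> carrier G"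
  shows "conj_by g (inv h) = inv (conj_by g h)"
  using assms by (simp add: conj_by_def inv_mult_group m_assoc)

lemma conj_by_conj_by:
  assumes "g \<in> carrier G" "h \<in> carrier G" "k \<in> carrier G"
  shows "conj_by h (conj_by g k) = conj_by (g \<otimes> h) k"
  using assms by (simp add: conj_by_def inv_mult_group m_assoc)

lemma conj_by_distrib:
  assumes "g \<in> carrier G" "h \<in> carrier G" "k \<in> carrier G"
  shows "conj_by g (conj_by h k) = conj_by (conj_by g h) (conj_by g k)"
  using assms by (simp add: conj_by_def inv_mult_group m_assoc cancel_left)

lemma conj_by_eq_if_commutes:
  assumes "g \<in> carrier G" "h \<in> carrier G" "k \<in> carrier G"
    and "(g \<otimes> inv h) \<otimes> k = k \<otimes> (g \<otimes> inv h)"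
  shows "conj_by h k = conj_by g k"
proof -
  have "inv g \<otimes> ((g \<otimes> inv h) \<otimes> k) \<otimes> h = inv g \<otimes> (k \<otimes> (g \<otimes> inv h)) \<otimes> h"
    using assms(4) by simp
  then show ?thesis using assms(1-3) by (simp add: conj_by_def m_assoc cancel_left)
qed

lemma commutes_if_conj_by_fixes:
  assumes "g \<in> carrier G" "h \<in> carrier G" "conj_by g h = h"
  shows "g \<otimes> h = h \<otimes> g"
proof -
  have "g \<otimes> h = g \<otimes> conj_by g h" using assms(3) by simp
  then show ?thesis using assms(1,2) by (simp add: conj_by_def m_assoc cancel_left)
qed

end

text \<open>Two elements that satisfy the relations of \<open>F\<close>. With \<open>a\<close> and \<open>b\<close> in the roles of \<open>x\<^sub>0\<close> and \<open>x\<^sub>1\<close>,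
  the element \<open>X n\<close> below is \<open>x\<^sub>n\<^sub>+\<^sub>1\<close>.\<close>

locale thompson_relations = group +
  fixes a b
  assumes a [simp]: "a \<in> carrier G" and b [simp]: "b \<in> carrier G"
    and commute1: "(a \<otimes> inv b) \<otimes> conj_by a b = conj_by a b \<otimes> (a \<otimes> inv b)"
    and commute2: "(a \<otimes> inv b) \<otimes> conj_by (a \<otimes> a) b = conj_by (a \<otimes> a) b \<otimes> (a \<otimes> inv b)"
begin

definition X :: "nat \<Rightarrow> 'a" where
  "X n = conj_by (a [^] n) b"

lemma X_closed [simp]: "X n \<in> carrier G"
  by (simp add: X_def)

lemma X_0: "X 0 = b"
  by (simp add: X_def conj_by_def)

lemma conj_by_pow_X: "conj_by (a [^] k) (X n) = X (n + k)"
  by (simp add: X_def conj_by_conj_by nat_pow_mult)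

lemma conj_by_a_X: "conj_by a (X n) = X (Suc n)"
  using conj_by_pow_X[of 1 n] by simp

text \<open>These are the relations \<open>x\<^sub>1\<^sup>-\<^sup>1 x\<^sub>j x\<^sub>1 = x\<^sub>j\<^sub>+\<^sub>1\<close> for \<open>j \<ge> 2\<close> of the infinite presentation. The
  two relators are the cases \<open>j = 2, 3\<close>. The case \<open>j = 2\<close> conjugated by a power of \<open>a\<close> expresses
  \<open>X (n + 2)\<close> through \<open>X n\<close> and \<open>X (n + 1)\<close>, and on these conjugation by \<open>a\<close> and by \<open>b\<close> agree by
  induction.\<close>

lemma conj_by_b_X_Suc: "conj_by b (X (Suc n)) = conj_by a (X (Suc n))"
proof -
  have base: "conj_by b (X 1) = conj_by a (X 1)" "conj_by b (X 2) = conj_by a (X 2)"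
    using conj_by_eq_if_commutes[of a b] commute1 commute2
    by (simp_all add: X_def numeral_2_eq_2)
  have "conj_by (X 0) (X 1) = X 2"
    using base(1) conj_by_a_X[of 1] by (simp add: X_0 numeral_2_eq_2)
  then have rel: "conj_by (X k) (X (Suc k)) = X (Suc (Suc k))" for k
    using conj_by_distrib[of "a [^] k" "X 0" "X 1"] by (simp add: conj_by_pow_X)
  show ?thesis
  proof (induction n rule: induct_nat_012)
    case (ge2 n)
    have "conj_by b (conj_by (X (Suc n)) (X (Suc (Suc n)))) =
        conj_by a (conj_by (X (Suc n)) (X (Suc (Suc n))))"
      using ge2 by (subst (1 2) conj_by_distrib) simp_all
    then show ?case by (simp add: rel)
  qed (use base in \<open>simp_all add: numeral_2_eq_2\<close>)
qed

text \<open>Acting on the line, \<open>right_part\<close> is supported on \<open>t \<ge> 0\<close> and \<open>left_part m\<close> on \<open>t \<le> 2 - m\<close>.\<close>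

definition right_part :: 'a where
  "right_part = inv b \<otimes> X 2 \<otimes> inv (X 1)"

definition left_part :: "nat \<Rightarrow> 'a" where
  "left_part m = a [^] (m - 1) \<otimes> b \<otimes> inv (a [^] m)"

lemma parts_closed [simp]: "right_part \<in> carrier G" "left_part m \<in> carrier G"
  by (simp_all add: right_part_def left_part_def)

lemma w_eq_left_right:
  "a [^] (m - 1) \<otimes> b \<otimes> X (m + 3) \<otimes> (inv (X (m + 2)) \<otimes> inv (X m)) \<otimes> inv (a [^] m)
    = left_part m \<otimes> right_part"
proof -
  have "X 3 \<otimes> inv (X 2) = conj_by b (X 2 \<otimes> inv (X 1))"
    using conj_by_b_X_Suc[of 0] conj_by_b_X_Suc[of 1]
    by (simp add: conj_by_mult conj_by_inv conj_by_a_X numeral_2_eq_2 numeral_3_eq_3)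
  then have v: "X 3 \<otimes> (inv (X 2) \<otimes> inv (X 0)) = right_part"
    by (simp add: conj_by_def right_part_def X_0 m_assoc flip: m_assoc[of "X 3"])
  have "conj_by (a [^] m) right_part = X (m + 3) \<otimes> (inv (X (m + 2)) \<otimes> inv (X m))"
    unfolding v[symmetric]
    by (simp add: conj_by_mult conj_by_inv conj_by_pow_X) (simp only: add.commute)
  then have "X (m + 3) \<otimes> (inv (X (m + 2)) \<otimes> inv (X m)) = inv (a [^] m) \<otimes> right_part \<otimes> a [^] m"
    by (simp add: conj_by_def)
  moreover have "a [^] (m - 1) \<otimes> b \<otimes> X (m + 3) \<otimes> (inv (X (m + 2)) \<otimes> inv (X m)) \<otimes> inv (a [^] m)
      = a [^] (m - 1) \<otimes> b \<otimes> (X (m + 3) \<otimes> (inv (X (m + 2)) \<otimes> inv (X m))) \<otimes> inv (a [^] m)"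
    by (simp add: m_assoc)
  ultimately have "a [^] (m - 1) \<otimes> b \<otimes> X (m + 3) \<otimes> (inv (X (m + 2)) \<otimes> inv (X m)) \<otimes> inv (a [^] m)
      = a [^] (m - 1) \<otimes> b \<otimes> (inv (a [^] m) \<otimes> right_part \<otimes> a [^] m) \<otimes> inv (a [^] m)"
    by (simp only:)
  also have "\<dots> = left_part m \<otimes> right_part"
    by (simp add: left_part_def m_assoc)
  finally show ?thesis .
qed

text \<open>Conjugated by \<open>a [^] (m - 1)\<close>, the left part is \<open>b \<otimes> inv a\<close>, which commutes with all \<open>X n\<close>,
  \<open>n \<ge> 1\<close>, and the right part is a product of such elements.\<close>

lemma left_right_commute:
  assumes "m \<ge> 2"
  shows "left_part m \<otimes> right_part = right_part \<otimes> left_part m"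
proof (rule commutes_if_conj_by_fixes)
  obtain k where m: "m = Suc k" and k: "k \<ge> 1" using assms by (cases m) auto
  let ?p = "a [^] k"
  have hb: "conj_by b (X j) = conj_by a (X j)" if "j \<ge> 1" for j
    using conj_by_b_X_Suc[of "j - 1"] that by simp
  have "conj_by ?p right_part = inv (X k) \<otimes> X (2 + k) \<otimes> inv (X (1 + k))"
    using conj_by_pow_X[of k 0]
    by (simp add: right_part_def conj_by_mult conj_by_inv conj_by_pow_X X_0)
  then have "conj_by b (conj_by ?p right_part) = conj_by a (conj_by ?p right_part)"
    using k by (simp add: conj_by_mult conj_by_inv hb)
  then have "conj_by (inv ?p) (conj_by (inv a) (conj_by b (conj_by ?p right_part))) =
      conj_by (inv ?p) (conj_by (inv a) (conj_by a (conj_by ?p right_part)))" by (simp only:)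
  also have "\<dots> = right_part"
    by (simp add: conj_by_conj_by m_assoc cancel_left) (simp add: conj_by_def)
  finally have "conj_by (inv ?p) (conj_by (inv a) (conj_by b (conj_by ?p right_part))) = right_part" .
  moreover have "left_part m = ?p \<otimes> b \<otimes> inv a \<otimes> inv ?p"
    by (simp add: left_part_def m inv_mult_group m_assoc)
  ultimately show "conj_by (left_part m) right_part = right_part"
    by (simp add: conj_by_conj_by m_assoc)
qed simp_all

end

section \<open>Words for the two end points\<close>

abbreviation elt :: "letter list \<Rightarrow> letter list set" where
  "elt \<equiv> pres_class thompson_relators"

interpretation F: group thompson_F by (rule group_thompson_F)

abbreviation F_mult (infixl "\<odot>" 70) where
  "g \<odot> h \<equiv> g \<otimes>\<^bsub>thompson_F\<^esub> h"

abbreviation F_inv where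
  "F_inv g \<equiv> inv\<^bsub>thompson_F\<^esub> g"

abbreviation F_pow (infixr "\<up>" 75) where
  "g \<up> n \<equiv> g [^]\<^bsub>thompson_F\<^esub> (n :: nat)"

declare thompson_x.simps(2) [simp del]

lemma elt_mult: "elt u \<odot> elt v = elt (u @ v)"
  by (simp add: thompson_F_def presented_group_mult)

lemma elt_Nil: "\<one>\<^bsub>thompson_F\<^esub> = elt []"
  by (simp add: thompson_F_def presented_group_one)

lemma elt_closed [simp]: "elt u \<in> carrier thompson_F"
  by (simp add: thompson_F_def presented_group_carrier)

lemma elt_inv: "F_inv (elt u) = elt (word_inv u)"
  by (rule F.inv_equality) (simp_all add: elt_mult elt_Nil pres_class_eq_iff pres_eq_word_inv)

lemma elt_pow: "elt [c] \<up> n = elt (replicate n c)"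
  by (induction n) (simp_all add: elt_Nil elt_mult replicate_append_same)

lemma elt_commute_if_relator:
  assumes "word_commutator u v \<in> thompson_relators"
  shows "elt u \<odot> elt v = elt v \<odot> elt u"
proof -
  have "elt (word_commutator u v) = elt []"
    using assms by (simp add: pres_class_eq_iff pres_relator)
  then have "elt u \<odot> elt v \<odot>
      F_inv (elt v \<odot> elt u) = \<one>\<^bsub>thompson_F\<^esub>"
    by (simp add: word_commutator_def elt_mult elt_inv elt_Nil word_inv_def)
  then show ?thesis
    using F.inv_solve_right[of "\<one>\<^bsub>thompson_F\<^esub>" "elt u \<odot> elt v"
        "elt v \<odot> elt u"] by simp
qed

lemma thompson_relators_commutators:
  "word_commutator [(X0, True), (X1, False)] [(X0, False), (X1, True), (X0, True)]
    \<in> thompson_relators"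
  "word_commutator [(X0, True), (X1, False)]
    [(X0, False), (X0, False), (X1, True), (X0, True), (X0, True)] \<in> thompson_relators"
  by (simp_all add: thompson_relators_def)

interpretation F: thompson_relations thompson_F "elt [(X0, True)]" "elt [(X1, True)]"
proof unfold_locales
  show "elt [(X0, True)] \<odot> F_inv (elt [(X1, True)]) \<odot>
      F.conj_by (elt [(X0, True)]) (elt [(X1, True)]) =
    F.conj_by (elt [(X0, True)]) (elt [(X1, True)]) \<odot>
      (elt [(X0, True)] \<odot> F_inv (elt [(X1, True)]))"
    using elt_commute_if_relator[OF thompson_relators_commutators(1)]
    by (simp add: F.conj_by_def elt_inv elt_mult word_inv_def)
  show "elt [(X0, True)] \<odot> F_inv (elt [(X1, True)]) \<odot>
      F.conj_by (elt [(X0, True)] \<odot> elt [(X0, True)]) (elt [(X1, True)]) =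
    F.conj_by (elt [(X0, True)] \<odot> elt [(X0, True)]) (elt [(X1, True)]) \<odot>
      (elt [(X0, True)] \<odot> F_inv (elt [(X1, True)]))"
    using elt_commute_if_relator[OF thompson_relators_commutators(2)]
    by (simp add: F.conj_by_def elt_inv elt_mult word_inv_def)
qed simp_all

lemma thompson_x_Suc: "thompson_x (Suc n) = F.X n"
  by (simp add: F.X_def F.conj_by_def thompson_x.simps(2))

lemma thompson_w_1: "thompson_w 1 m = F.left_part m \<odot> F.right_part"
proof -
  have "map (\<lambda>j. F_inv (thompson_x (m + 2 * j + 1))) (rev [0..<Suc 1])
      = [F_inv (F.X (m + 2)), F_inv (F.X m)]"
    by (simp add: upt_rec[of 0] thompson_x_Suc)
  then have "thompson_w 1 m = elt [(X0, True)] \<up> (m - 1) \<odot> elt [(X1, True)] \<odot> F.X (m + 3) \<odot>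
      (F_inv (F.X (m + 2)) \<odot> F_inv (F.X m)) \<odot> F_inv (elt [(X0, True)] \<up> m)"
    by (simp add: thompson_w_def list_mult_def thompson_x_Suc F.X_0 eval_nat_numeral)
  then show ?thesis by (simp only: F.w_eq_left_right)
qed

text \<open>A word for \<open>right_part\<close> followed by \<open>x\<^sub>0\<^sup>-\<^sup>1\<close>.\<close>

definition right_word :: "letter list" where
  "right_word = [(X1, False), (X0, False), (X0, False), (X1, True), (X0, True), (X1, False)]"

lemma elt_cancel: "elt (u @ (g, b) # (g, \<not> b) # v) = elt (u @ v)"
  using pres_cong[OF pres_refl pres_cong[OF pres_cancel pres_refl], of thompson_relators u g b v]
  by (simp add: pres_class_eq_iff)

lemma right_part_elt: "F.right_part = elt (right_word @ [(X0, True)])"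
proof -
  have "F.right_part = elt ([(X1, False), (X0, False), (X0, False), (X1, True), (X0, True)] @
      (X0, True) # (X0, \<not> True) # [(X1, False), (X0, True)])"
    by (simp add: F.right_part_def F.X_def F.conj_by_def elt_inv elt_mult elt_pow word_inv_def
      numeral_2_eq_2)
  then show ?thesis by (simp only: elt_cancel) (simp add: right_word_def)
qed

lemma left_part_elt:
  "F.left_part m = elt (replicate (m - 1) (X0, True) @ (X1, True) # replicate m (X0, False))"
  by (simp add: F.left_part_def elt_pow elt_inv word_inv_def elt_mult)

text \<open>Both words are shorter by two letters than concatenating the parts and \<open>x\<^sub>0\<^sup>\<plusminus>\<^sup>1\<close> suggests: the last
  letter cancels exactly when the part that ends with its inverse comes last.\<close>

definition right_first :: "nat \<Rightarrow> letter list" where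
  "right_first m = right_word @ replicate m (X0, True) @ (X1, True) # replicate (m - 1) (X0, False)"

definition left_first :: "nat \<Rightarrow> letter list" where
  "left_first m = replicate (m - 1) (X0, True) @ (X1, True) # replicate m (X0, False) @ right_word"

lemma w_forward_elt:
  assumes "m \<ge> 2"
  shows "thompson_w 1 m \<odot> thompson_x 0 = elt (right_first m)"
proof -
  obtain k where m: "m = Suc k" using assms by (cases m) auto
  have "thompson_w 1 m \<odot> thompson_x 0 = F.right_part \<odot> F.left_part m \<odot> elt [(X0, True)]"
    unfolding thompson_w_1 using F.left_right_commute[OF assms] by simp
  also have "\<dots> = elt ((right_word @ replicate (Suc k) (X0, True) @ (X1, True) # replicate k (X0, False)) @
      (X0, False) # (X0, \<not> False) # [])"
    by (simp add: right_part_elt left_part_elt elt_mult m replicate_app_Cons_same)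
  also have "\<dots> = elt (right_first m)"
    by (simp only: elt_cancel) (simp add: right_first_def m)
  finally show ?thesis .
qed

lemma w_backward_elt: "thompson_w 1 m \<odot> F_inv (thompson_x 0) = elt (left_first m)"
proof -
  have "thompson_w 1 m \<odot> F_inv (thompson_x 0) =
      elt ((replicate (m - 1) (X0, True) @ (X1, True) # replicate m (X0, False) @ right_word) @
        (X0, True) # (X0, \<not> True) # [])"
    unfolding thompson_w_1
    by (simp add: left_part_elt right_part_elt elt_mult elt_inv word_inv_def)
  also have "\<dots> = elt (left_first m)"
    by (simp only: elt_cancel) (simp add: left_first_def)
  finally show ?thesis .
qed

lemma run_replicate:
  "run (replicate n (X0, True)) (t, h) = (t + n, h)"
  "run (replicate n (X0, False)) (t, h) = (t - n, h)"
  by (induction n arbitrary: t) simp_all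

lemma count_replicate:
  "count_list (replicate n c) d = (if c = d then n else 0)"
  by (induction n) auto

lemma right_first_facts:
  assumes "m \<ge> 3"
  shows "pos (right_first m) (1 - real m) = 1 - real m"
    "pos (right_first m) (2 - real m) = 3 - real m"
    "run (right_first m) (3, 0) = (5 / 2, 0)"
    "stretches (right_first m) = shrinks (right_first m)"
    "length (right_first m) = 2 * m + 6"
  using assms
  by (simp_all add: right_first_def right_word_def pos_def run_replicate count_replicate)

lemma left_first_facts:
  assumes "m \<ge> 3"
  shows "pos (left_first m) (1 - real m) = - 1 - real m"
    "pos (left_first m) (2 - real m) = 1 - real m"
    "run (left_first m) (3, 0) = (1 / 2, 0)"
    "stretches (left_first m) = shrinks (left_first m)"
    "length (left_first m) = 2 * m + 6"
  using assms
  by (simp_all add: left_first_def right_word_def pos_def run_replicate count_replicate)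

section \<open>From paths in the Cayley graph to words\<close>

lemma sym_gens_thompson: "sym_gens thompson_F thompson_gens = range (\<lambda>c. elt [c])"
proof -
  have "c \<in> {(X0, True), (X0, False), (X1, True), (X1, False)}" for c :: letter
    by (cases c rule: letter_cases) simp_all
  then have letters: "(UNIV :: letter set) = {(X0, True), (X0, False), (X1, True), (X1, False)}"
    by blast
  show ?thesis
    unfolding letters sym_gens_def thompson_gens_def thompson_x_1
    by (auto simp: elt_inv word_inv_def)
qed

lemma list_mult_letters: "list_mult thompson_F (map (\<lambda>c. elt [c]) W) = elt W"
  by (induction W) (simp_all add: list_mult_def elt_Nil elt_mult)

lemma path_word:
  assumes "is_path thompson_F thompson_gens p"
  shows "\<exists>W. p = map (\<lambda>c. elt [c]) W"
proof -
  have "\<forall>g\<in>set p. \<exists>c. g = elt [c]"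
    using assms unfolding is_path_def sym_gens_thompson by blast
  then show ?thesis by (simp only: ex_map_conv)
qed

lemma path_at_letters: "path_at thompson_F (map (\<lambda>c. elt [c]) W) i = elt (take i W)"
  by (simp add: path_at_def take_map list_mult_letters)

lemma word_length_le: "word_length thompson_F thompson_gens (elt W) \<le> length W"
  unfolding word_length_def
  by (rule Least_le) (auto intro!: exI[of _ "map (\<lambda>c. elt [c]) W"]
    simp: list_mult_letters sym_gens_thompson)

lemma word_length_attained:
  "\<exists>U. elt U = elt W \<and> length U = word_length thompson_F thompson_gens (elt W)"
proof -
  have "\<exists>gs. set gs \<subseteq> sym_gens thompson_F thompson_gens \<and>
      length gs = word_length thompson_F thompson_gens (elt W) \<and> list_mult thompson_F gs = elt W"
    unfolding word_length_def
    by (rule LeastI_ex) (auto intro!: exI[of _ "map (\<lambda>c. elt [c]) W"]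
      simp: list_mult_letters sym_gens_thompson)
  then obtain gs where gs: "is_path thompson_F thompson_gens gs"
      "length gs = word_length thompson_F thompson_gens (elt W)" "list_mult thompson_F gs = elt W"
    by (auto simp: is_path_def)
  from path_word[OF gs(1)] obtain U where "gs = map (\<lambda>c. elt [c]) U" by blast
  with gs(2,3) show ?thesis by (intro exI[of _ U]) (simp add: list_mult_letters)
qed

lemma thompson_gens_closed: "thompson_gens \<subseteq> carrier thompson_F"
  by (auto simp: thompson_gens_def thompson_x_Suc)

lemma cayley_dist_elt:
  "cayley_dist thompson_F thompson_gens (elt U) (elt V) =
    word_length thompson_F thompson_gens (elt (word_inv U @ V))"
  using cayley_dist_eq_word_length[OF group_thompson_F thompson_gens_closed]
  by (simp add: elt_inv elt_mult)

lemma short_connecting_word: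
  "\<exists>Z. elt (U @ Z) = elt V \<and> length Z = cayley_dist thompson_F thompson_gens (elt U) (elt V)"
proof -
  obtain Z where Z: "elt Z = elt (word_inv U @ V)"
      "length Z = cayley_dist thompson_F thompson_gens (elt U) (elt V)"
    using word_length_attained[of "word_inv U @ V"] unfolding cayley_dist_elt by blast
  have "elt (U @ Z) = elt U \<odot> (F_inv (elt U) \<odot> elt V)"
    by (simp add: Z(1) elt_inv flip: elt_mult)
  also have "\<dots> = elt V" by (rule F.cancel_left) simp_all
  finally show ?thesis using Z(2) by blast
qed

lemma cayley_dist_backward:
  assumes "g \<in> carrier thompson_F"
  shows "cayley_dist thompson_F thompson_gens g (g \<odot> F_inv (thompson_x 0)) = 1"
proof -
  have "F_inv g \<odot> (g \<odot> F_inv (thompson_x 0)) = elt [(X0, False)]"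
    using assms by (simp add: F.cancel_left elt_inv word_inv_def)
  then have "cayley_dist thompson_F thompson_gens g (g \<odot> F_inv (thompson_x 0)) =
      word_length thompson_F thompson_gens (elt [(X0, False)])"
    using cayley_dist_eq_word_length[OF group_thompson_F thompson_gens_closed assms] assms by simp
  moreover have "word_length thompson_F thompson_gens (elt [(X0, False)]) \<noteq> 0"
  proof
    assume "word_length thompson_F thompson_gens (elt [(X0, False)]) = 0"
    then have "elt [] = elt [(X0, False)]" using word_length_attained[of "[(X0, False)]"] by auto
    then have "run [] (0, 0) = run [(X0, False)] (0, 0)"
      by (intro run_pres_eq) (simp add: pres_class_eq_iff)
    then show False by simp
  qed
  ultimately show ?thesis using word_length_le[of "[(X0, False)]"] by simp
qed

text \<open>Only pairs of paths whose end points are adjacent through \<open>x\<^sub>0\<^sup>-\<^sup>1\<close> are compared: \<open>w x\<^sub>0\<close> with \<open>w\<close>,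
  and \<open>w\<close> with \<open>w x\<^sub>0\<^sup>-\<^sup>1\<close>.\<close>

lemma cayley_dist_le_if_fellow_travel:
  assumes "fellow_traveller_property thompson_F thompson_gens k P" "p \<in> P" "q \<in> P"
    and "path_end thompson_F q = path_end thompson_F p \<odot> F_inv (thompson_x 0)"
    and "path_end thompson_F p \<in> carrier thompson_F" "i \<ge> 1"
  shows "real (cayley_dist thompson_F thompson_gens (path_at thompson_F p i) (path_at thompson_F q i)) \<le> k"
proof -
  have "cayley_dist thompson_F thompson_gens (path_at thompson_F p i) (path_at thompson_F q i)
      \<le> sync_dist thompson_F thompson_gens p q"
    unfolding sync_dist_def using finite_sync_dist_values assms(6) by (intro Max_ge) auto
  moreover have "real (sync_dist thompson_F thompson_gens p q) \<le> k"
    using assms(1-5) cayley_dist_backward[of "path_end thompson_F p"]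
    unfolding fellow_traveller_property_def by simp
  ultimately show ?thesis by linarith
qed

lemma geodesic_word:
  assumes "geodesic_to thompson_F thompson_gens (elt V) p"
  shows "\<exists>W. p = map (\<lambda>c. elt [c]) W \<and> elt W = elt V \<and> length W \<le> length V"
  using assms path_word[of p] word_length_le[of V]
  by (auto simp: geodesic_to_def path_end_def list_mult_letters)

section \<open>Geodesics to neighbouring vertices that do not fellow travel\<close>

theorem proposition4p2:
  fixes k :: real
  shows "\<exists>w\<in>thompson_S.
    \<not> (\<exists>\<gamma> \<gamma>\<^sub>p \<gamma>\<^sub>m.
        geodesic_to thompson_F thompson_gens w \<gamma> \<and>
        geodesic_to thompson_F thompson_gens (w \<otimes>\<^bsub>thompson_F\<^esub> thompson_x 0) \<gamma>\<^sub>p \<and>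
        geodesic_to thompson_F thompson_gens (w \<otimes>\<^bsub>thompson_F\<^esub> inv\<^bsub>thompson_F\<^esub> thompson_x 0) \<gamma>\<^sub>m \<and>
        fellow_traveller_property thompson_F thompson_gens k {\<gamma>, \<gamma>\<^sub>p, \<gamma>\<^sub>m})"
proof -
  \<comment> \<open>The paths to \<open>w x\<^sub>0\<close> and \<open>w x\<^sub>0\<^sup>-\<^sup>1\<close> are both compared with the one to \<open>w\<close>, hence the factor 2.\<close>
  define K where "K = 2 * nat \<lfloor>k\<rfloor>"
  define m where "m = K + 6"
  let ?w = "thompson_w 1 m"
  have m: "m \<ge> 3" by (simp add: m_def)
  have "?w \<in> thompson_S" using m unfolding thompson_S_def by (intro CollectI exI[of _ 1] exI[of _ m]) simp
  moreover have False
    if \<gamma>: "geodesic_to thompson_F thompson_gens ?w \<gamma>"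
      and \<gamma>p: "geodesic_to thompson_F thompson_gens (?w \<odot> thompson_x 0) \<gamma>p"
      and \<gamma>m: "geodesic_to thompson_F thompson_gens (?w \<odot> F_inv (thompson_x 0)) \<gamma>m"
      and ft: "fellow_traveller_property thompson_F thompson_gens k {\<gamma>, \<gamma>p, \<gamma>m}"
    for \<gamma> \<gamma>p \<gamma>m
  proof -
    have wc: "?w \<in> carrier thompson_F" unfolding thompson_w_1 by simp
    obtain W where W: "\<gamma>p = map (\<lambda>c. elt [c]) W" "elt W = elt (right_first m)"
        "length W \<le> length (right_first m)"
      using geodesic_word[of "right_first m" \<gamma>p] \<gamma>p w_forward_elt[of m] m by auto
    obtain W' where W': "\<gamma>m = map (\<lambda>c. elt [c]) W'" "elt W' = elt (left_first m)"
        "length W' \<le> length (left_first m)"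
      using geodesic_word[of "left_first m" \<gamma>m] \<gamma>m w_backward_elt[of m] by auto
    obtain V where V: "\<gamma> = map (\<lambda>c. elt [c]) V"
      using \<gamma> path_word by (auto simp: geodesic_to_def)
    have ends: "path_end thompson_F \<gamma> = ?w" "path_end thompson_F \<gamma>p = ?w \<odot> thompson_x 0"
      "path_end thompson_F \<gamma>m = ?w \<odot> F_inv (thompson_x 0)"
      using \<gamma> \<gamma>p \<gamma>m by (simp_all add: geodesic_to_def)
    have "\<exists>U. length U \<le> K \<and> (\<forall>s. run (take i W @ U) s = run (take i W') s)" if "i \<ge> 1" for i
    proof -
      have "real (cayley_dist thompson_F thompson_gens (elt (take i W)) (elt (take i V))) \<le> k"
        using cayley_dist_le_if_fellow_travel[OF ft, of \<gamma>p \<gamma> i] that wc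
        by (simp add: ends F.m_assoc) (simp add: W V path_at_letters)
      moreover have "real (cayley_dist thompson_F thompson_gens (elt (take i V)) (elt (take i W'))) \<le> k"
        using cayley_dist_le_if_fellow_travel[OF ft, of \<gamma> \<gamma>m i] that wc
        by (simp add: ends F.m_assoc) (simp add: W' V path_at_letters)
      ultimately obtain U1 U2 where
          U1: "elt (take i W @ U1) = elt (take i V)" "real (length U1) \<le> k" and
          U2: "elt (take i V @ U2) = elt (take i W')" "real (length U2) \<le> k"
        using short_connecting_word by metis
      have "elt (take i W @ U1 @ U2) = elt (take i W')"
        using U1(1) U2(1) by (metis append.assoc elt_mult)
      then have "\<forall>s. run (take i W @ U1 @ U2) s = run (take i W') s"
        unfolding pres_class_eq_iff by (intro allI run_pres_eq)
      moreover have "length (U1 @ U2) \<le> K"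
        using le_nat_floor[OF U1(2)] le_nat_floor[OF U2(2)] by (simp add: K_def)
      ultimately show ?thesis by blast
    qed
    moreover have "pos W t = pos (right_first m) t" "run W s = run (right_first m) s"
      "pos W' t = pos (left_first m) t" "run W' s = run (left_first m) s" for s t
      using W(2) W'(2) run_pres_eq by (simp_all add: pos_def pres_class_eq_iff)
    moreover have "stretches W = shrinks W" "stretches W' = shrinks W'"
      using W(2) W'(2) balance_pres_eq[of W "right_first m"] balance_pres_eq[of W' "left_first m"]
        right_first_facts(4)[OF m] left_first_facts(4)[OF m]
      by (simp_all add: pres_class_eq_iff)
    ultimately show False
      using short_words_diverge[of K m W W'] right_first_facts[OF m] left_first_facts[OF m]
        W(3) W'(3) by (simp add: m_def)
  qed
  ultimately show ?thesis by blast
qed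

end
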